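(* Let $\mathcal{K}=(\mathcal{O},\mathcal{A})$ be a TLD-Lite KB whose ABox contains exactly $d$ distribution-eventuality assertions $\bigcirc^{n_i}\mathsf{E}_{\delta_i}\theta_i(\mathbf a_i)$, $1\le i\le d$. Then $\mathcal{K}$ is satisfiable iff there is a $d$-dimensional infinite matrix $M$ indexed by $\mathbb{N}^d$ with entries in $[0,1]$ such that (i) for every $(k_1,\dots,k_d)\in\mathbb{N}^d$, if $M(k_1,\dots,k_d)>0$ then the temporal KB $(\mathcal{O},\mathcal{A}_{k_1,\dots,k_d})$ is satisfiable, where $\mathcal{A}_{k_1,\dots,k_d}$ is the ABox without distribution-eventuality assertions $$\bigcup_{i=1}^{d}\Big(\{\bigcirc^{n_i+j}\neg\theta_i(\mathbf a_i)\mid 0\le j<k_i\}\cup\{\bigcirc^{n_i+k_i}\theta_i(\mathbf a_i)\}\Big)\ \cup\ \Big(\mathcal{A}\setminus\{\bigcirc^{n_i}\mathsf{E}_{\delta_i}\theta_i(\mathbf a_i)\mid 1\le i\le d\}\Big);$$ and (ii) for every $1\le i\le d$ and every $k_i\in\mathbb{N}$, $\sum M(k_1,\dots,k_d)=\delta_i(k_i)$, where the sum ranges over all values in $\mathbb{N}$ of the other $d-1$ indices (with the $i$-th index fixed to $k_i$).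
   Context: TLD-Lite: temporal DL-Lite with operators $\bigcirc,\Diamond,\Box,\mathcal{U}$ over $(\mathbb{N},<)$ (non-strict semantics, constant domain), ontology $\mathcal{O}$ of globally holding concept and role inclusions, and ABox assertions $\bigcirc^n A(a)$, $\bigcirc^n\neg A(a)$, $\bigcirc^n R(a,b)$, $\bigcirc^n\neg R(a,b)$ and distribution-eventuality assertions $\bigcirc^n\mathsf{E}_\delta\theta(\mathbf a)$ with $\delta$ a complete distribution over $\mathbb{N}$. A model is a pair $(\mathfrak{I},\mu)$ of a set of temporal interpretations and a probability measure on it such that every $\mathcal{I}\in\mathfrak{I}$ satisfies $\mathcal{O}$ and the ordinary ABox assertions, and for each $\bigcirc^n\mathsf{E}_\delta\theta(\mathbf a)$ the $\mu$-probability that $\theta(\mathbf a)$ first holds at time $n+i$ (counting from $n$) equals $\delta(i)$ for all $i\ge0$. The entry $M(k_1,\dots,k_d)$ intuitively is the probability that, for each $i$, $\theta_i(\mathbf a_i)$ is first observed exactly $k_i$ steps after time $n_i$. *)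

theory Defs
  imports "HOL-Probability.Probability"
begin

section \<open>Syntax\<close>

datatype 'r role = RName 'r | RInv 'r

text \<open>Together with Boolean-closed inclusions this is the union of the usual temporal DL-Lite
  dialects: \<open>\<exists>R\<close> is \<open>AtLeast 1 R\<close>, a rigid role \<open>R\<close> is given by the inclusions
  \<open>R \<sqsubseteq> \<box>R\<close> and \<open>\<diamond>R \<sqsubseteq> R\<close>, and \<open>\<sqinter>C\<^sub>i \<sqsubseteq> \<squnion>D\<^sub>j\<close> and disjointness axioms are obtained
  from negation and conjunction. Number restrictions are unqualified and apply to
  non-temporalised roles only.\<close>

datatype ('c, 'r) concept =
    CBot
  | CName 'c
  | AtLeast nat "'r role"
  | CNot "('c, 'r) concept"
  | CAnd "('c, 'r) concept" "('c, 'r) concept"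
  | CNext "('c, 'r) concept"
  | CDiamond "('c, 'r) concept"
  | CBox "('c, 'r) concept"
  | CUntil "('c, 'r) concept" "('c, 'r) concept"

datatype 'r trole =
    Role "'r role"
  | RNot "'r trole"
  | RAnd "'r trole" "'r trole"
  | RNext "'r trole"
  | RDiamond "'r trole"
  | RBox "'r trole"
  | RUntil "'r trole" "'r trole"

datatype ('c, 'r) inclusion =
    CI "('c, 'r) concept" "('c, 'r) concept"
  | RI "'r trole" "'r trole"

type_synonym ('c, 'r) ontology = "('c, 'r) inclusion set"

text \<open>An atom is the \<open>\<theta>(\<^bold>a)\<close> of an assertion: a concept name applied to one individual or
  a role applied to two.\<close>

datatype ('c, 'r, 'i) atom =
    CAtom 'c 'i
  | RAtom "'r role" 'i 'i

text \<open>\<open>Pos n \<phi>\<close> is \<open>\<circle>\<^sup>n \<phi>\<close> and \<open>Neg n \<phi>\<close> is \<open>\<circle>\<^sup>n \<not>\<phi>\<close>; \<open>DistEv n \<delta> \<phi>\<close> is the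
  distribution-eventuality assertion \<open>\<circle>\<^sup>n E\<^sub>\<delta> \<phi>\<close>. A \<open>nat pmf\<close> has total mass 1, so it is
  a complete distribution.\<close>

datatype ('c, 'r, 'i) tassertion =
    Pos nat "('c, 'r, 'i) atom"
  | Neg nat "('c, 'r, 'i) atom"

datatype ('c, 'r, 'i) assertion =
    Ordinary "('c, 'r, 'i) tassertion"
  | is_DistEv: DistEv nat "nat pmf" "('c, 'r, 'i) atom"

type_synonym ('c, 'r, 'i) tabox = "('c, 'r, 'i) tassertion set"
type_synonym ('c, 'r, 'i) abox = "('c, 'r, 'i) assertion set"

section \<open>Temporal interpretations\<close>

text \<open>The domain is any nonempty subset of the type \<open>'u\<close>. It does not depend on time, and neither
  does the interpretation of individual names. The unique name assumption is not imposed.\<close>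

record ('c, 'r, 'i, 'u) tinterp =
  tdom :: "'u set"
  iint :: "'i \<Rightarrow> 'u"
  cint :: "nat \<Rightarrow> 'c \<Rightarrow> 'u set"
  rint :: "nat \<Rightarrow> 'r \<Rightarrow> ('u \<times> 'u) set"

definition temporal_interp :: "('c, 'r, 'i, 'u) tinterp \<Rightarrow> bool" where
  "temporal_interp I \<longleftrightarrow>
     tdom I \<noteq> {} \<and> (\<forall>a. iint I a \<in> tdom I) \<and>
     (\<forall>n A. cint I n A \<subseteq> tdom I) \<and> (\<forall>n P. rint I n P \<subseteq> tdom I \<times> tdom I)"

primrec role_ext :: "('c, 'r, 'i, 'u) tinterp \<Rightarrow> nat \<Rightarrow> 'r role \<Rightarrow> ('u \<times> 'u) set" where
  "role_ext I n (RName P) = rint I n P"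
| "role_ext I n (RInv P) = (rint I n P)\<inverse>"

text \<open>In \<open>AtLeast\<close>, the existence of a \<open>q\<close>-element set of successors also covers infinitely many
  successors, whose \<open>card\<close> would be 0.\<close>

primrec concept_ext :: "('c, 'r, 'i, 'u) tinterp \<Rightarrow> ('c, 'r) concept \<Rightarrow> nat \<Rightarrow> 'u set" where
  "concept_ext I CBot n = {}"
| "concept_ext I (CName A) n = cint I n A"
| "concept_ext I (AtLeast q R) n =
     {x \<in> tdom I. \<exists>Y. finite Y \<and> card Y = q \<and> (\<forall>y\<in>Y. (x, y) \<in> role_ext I n R)}"
| "concept_ext I (CNot C) n = tdom I - concept_ext I C n"
| "concept_ext I (CAnd C D) n = concept_ext I C n \<inter> concept_ext I D n"
| "concept_ext I (CNext C) n = concept_ext I C (Suc n)"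
| "concept_ext I (CDiamond C) n = (\<Union>m\<in>{n..}. concept_ext I C m)"
| "concept_ext I (CBox C) n = (\<Inter>m\<in>{n..}. concept_ext I C m)"
| "concept_ext I (CUntil C D) n =
     {x. \<exists>m\<ge>n. x \<in> concept_ext I D m \<and> (\<forall>l\<in>{n..<m}. x \<in> concept_ext I C l)}"

primrec trole_ext :: "('c, 'r, 'i, 'u) tinterp \<Rightarrow> 'r trole \<Rightarrow> nat \<Rightarrow> ('u \<times> 'u) set" where
  "trole_ext I (Role R) n = role_ext I n R"
| "trole_ext I (RNot S) n = tdom I \<times> tdom I - trole_ext I S n"
| "trole_ext I (RAnd S T) n = trole_ext I S n \<inter> trole_ext I T n"
| "trole_ext I (RNext S) n = trole_ext I S (Suc n)"
| "trole_ext I (RDiamond S) n = (\<Union>m\<in>{n..}. trole_ext I S m)"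
| "trole_ext I (RBox S) n = (\<Inter>m\<in>{n..}. trole_ext I S m)"
| "trole_ext I (RUntil S T) n =
     {p. \<exists>m\<ge>n. p \<in> trole_ext I T m \<and> (\<forall>l\<in>{n..<m}. p \<in> trole_ext I S l)}"

primrec sat_inclusion :: "('c, 'r, 'i, 'u) tinterp \<Rightarrow> ('c, 'r) inclusion \<Rightarrow> bool" where
  "sat_inclusion I (CI C D) \<longleftrightarrow> (\<forall>n. concept_ext I C n \<subseteq> concept_ext I D n)"
| "sat_inclusion I (RI S T) \<longleftrightarrow> (\<forall>n. trole_ext I S n \<subseteq> trole_ext I T n)"

primrec holds_at :: "('c, 'r, 'i, 'u) tinterp \<Rightarrow> nat \<Rightarrow> ('c, 'r, 'i) atom \<Rightarrow> bool" where
  "holds_at I n (CAtom A a) \<longleftrightarrow> iint I a \<in> cint I n A"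
| "holds_at I n (RAtom R a b) \<longleftrightarrow> (iint I a, iint I b) \<in> role_ext I n R"

primrec sat_tassertion :: "('c, 'r, 'i, 'u) tinterp \<Rightarrow> ('c, 'r, 'i) tassertion \<Rightarrow> bool" where
  "sat_tassertion I (Pos n \<phi>) \<longleftrightarrow> holds_at I n \<phi>"
| "sat_tassertion I (Neg n \<phi>) \<longleftrightarrow> \<not> holds_at I n \<phi>"

definition temporal_model ::
  "('c, 'r, 'i, 'u) tinterp \<Rightarrow> ('c, 'r) ontology \<Rightarrow> ('c, 'r, 'i) tabox \<Rightarrow> bool" where
  "temporal_model I Ont B \<longleftrightarrow>
     temporal_interp I \<and> (\<forall>\<iota>\<in>Ont. sat_inclusion I \<iota>) \<and> (\<forall>\<alpha>\<in>B. sat_tassertion I \<alpha>)"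

text \<open>HOL cannot quantify over types, so both notions of satisfiability take the type from
  which the domains are drawn as a parameter.\<close>

definition temporal_satisfiable ::
  "'u itself \<Rightarrow> ('c, 'r) ontology \<Rightarrow> ('c, 'r, 'i) tabox \<Rightarrow> bool" where
  "temporal_satisfiable _ Ont B \<longleftrightarrow> (\<exists>I :: ('c, 'r, 'i, 'u) tinterp. temporal_model I Ont B)"

section \<open>Models with distribution eventualities\<close>

text \<open>\<open>first_at I n \<phi> i\<close>: counting from time \<open>n\<close>, \<open>\<phi>\<close> holds for the first time after \<open>i\<close> steps.\<close>

definition first_at :: "('c, 'r, 'i, 'u) tinterp \<Rightarrow> nat \<Rightarrow> ('c, 'r, 'i) atom \<Rightarrow> nat \<Rightarrow> bool" where
  "first_at I n \<phi> i \<longleftrightarrow> holds_at I (n + i) \<phi> \<and> (\<forall>j<i. \<not> holds_at I (n + j) \<phi>)"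

text \<open>\<open>measure\<close> is 0 on non-measurable sets, so measurability of the events has to be required
  explicitly for their probabilities to be meaningful.\<close>

definition kb_model ::
  "('c, 'r, 'i, 'u) tinterp set \<Rightarrow> ('c, 'r, 'i, 'u) tinterp measure \<Rightarrow>
   ('c, 'r) ontology \<Rightarrow> ('c, 'r, 'i) abox \<Rightarrow> bool" where
  "kb_model \<II> \<mu> Ont A \<longleftrightarrow>
     prob_space \<mu> \<and> space \<mu> = \<II> \<and>
     (\<forall>I\<in>\<II>. temporal_model I Ont (Ordinary -` A)) \<and>
     (\<forall>n \<delta> \<phi>. DistEv n \<delta> \<phi> \<in> A \<longrightarrow>
        (\<forall>i. {I \<in> \<II>. first_at I n \<phi> i} \<in> sets \<mu> \<and>
             measure \<mu> {I \<in> \<II>. first_at I n \<phi> i} = pmf \<delta> i))"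

definition kb_satisfiable ::
  "'u itself \<Rightarrow> ('c, 'r) ontology \<Rightarrow> ('c, 'r, 'i) abox \<Rightarrow> bool" where
  "kb_satisfiable _ Ont A \<longleftrightarrow>
     (\<exists>(\<II> :: ('c, 'r, 'i, 'u) tinterp set) \<mu>. kb_model \<II> \<mu> Ont A)"

section \<open>Fixing the first occurrences\<close>

text \<open>The ABox \<open>A\<^sub>k\<^sub>1\<^sub>,\<^sub>.\<^sub>.\<^sub>.\<^sub>,\<^sub>k\<^sub>d\<close>. The preimage under \<open>Ordinary\<close> only changes the type:
  the theorem assumes that the removed assertions are all the distribution eventualities of \<open>A\<close>.\<close>

definition instantiated_abox ::
  "nat \<Rightarrow> (nat \<Rightarrow> nat) \<Rightarrow> (nat \<Rightarrow> nat pmf) \<Rightarrow> (nat \<Rightarrow> ('c, 'r, 'i) atom) \<Rightarrow>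
   ('c, 'r, 'i) abox \<Rightarrow> (nat \<Rightarrow> nat) \<Rightarrow> ('c, 'r, 'i) tabox" where
  "instantiated_abox d n \<delta> \<theta> A k =
     (\<Union>i\<in>{1..d}. {Neg (n i + j) (\<theta> i) | j. j < k i} \<union> {Pos (n i + k i) (\<theta> i)}) \<union>
     Ordinary -` (A - {DistEv (n i) (\<delta> i) (\<theta> i) | i. i \<in> {1..d}})"

text \<open>\<open>\<nat>\<^sup>d\<close> with coordinates \<open>1, \<dots>, d\<close>; outside these the tuples are \<open>undefined\<close>, so each tuple
  is represented exactly once.\<close>

abbreviation index_tuples :: "nat \<Rightarrow> (nat \<Rightarrow> nat) set" where
  "index_tuples d \<equiv> {1..d} \<rightarrow>\<^sub>E UNIV"

end

theory Submission imports Defs begin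

text \<open>Given a model, let \<open>M k\<close> be the probability that the vector of first occurrence times
  is \<open>k\<close>. Each eventuality occurs almost surely since \<open>\<delta>\<^sub>i\<close> has total mass 1, so the marginals
  of \<open>M\<close> are the \<open>\<delta>\<^sub>i\<close>, and an event of positive probability contains an interpretation
  satisfying the instantiated ABox. Conversely, \<open>M\<close> is a probability mass function because
  any of its marginals is one; choosing a temporal model for every tuple in its support and
  pushing \<open>M\<close> forward along this choice yields a discrete model of the knowledge base.\<close>

section \<open>Sums of nonnegative families and countable additivity\<close>

text \<open>Bridges \<open>ennreal\<close> integrals, the language of \<open>emeasure\<close> and
  \<open>embed_pmf\<close>, and \<open>has_sum\<close>, the language of the marginals. For
  nonnegative reals summability and absolute summability coincide. The bound on \<open>S\<close> is
  there because \<open>ennreal\<close> sends negative reals to 0.\<close>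

lemma nn_integral_count_space_eq_iff_has_sum:
  fixes f :: "'a \<Rightarrow> real"
  assumes nonneg: "\<And>x. x \<in> A \<Longrightarrow> f x \<ge> 0" and "S \<ge> 0"
  shows "(\<integral>\<^sup>+x. ennreal (f x) \<partial>count_space A) = ennreal S \<longleftrightarrow> (f has_sum S) A"
proof
  assume int: "(\<integral>\<^sup>+x. ennreal (f x) \<partial>count_space A) = ennreal S"
  have "integrable (count_space A) f"
    using nonneg int by (intro integrableI_nonneg) (auto simp: AE_count_space)
  then have abs: "Infinite_Set_Sum.abs_summable_on f A"
    by (simp add: Infinite_Set_Sum.abs_summable_on_def)
  have "ennreal (infsetsum f A) = ennreal S"
    using nn_integral_conv_infsetsum[OF abs nonneg] int by simp
  moreover have "infsetsum f A \<ge> 0"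
    using nonneg by (rule infsetsum_nonneg)
  ultimately have "infsum f A = S"
    using \<open>S \<ge> 0\<close> infsetsum_infsum[OF abs] by simp
  moreover have "f summable_on A"
    using abs abs_summable_equivalent abs_summable_summable by blast
  ultimately show "(f has_sum S) A"
    using has_sum_infsum by blast
next
  assume sum: "(f has_sum S) A"
  then have "f summable_on A"
    by (rule has_sum_imp_summable)
  then have abs: "Infinite_Set_Sum.abs_summable_on f A"
    using abs_summable_equivalent summable_on_iff_abs_summable_on_real by blast
  show "(\<integral>\<^sup>+x. ennreal (f x) \<partial>count_space A) = ennreal S"
    using nn_integral_conv_infsetsum[OF abs nonneg] infsetsum_infsum[OF abs] infsumI[OF sum]
    by simp
qed

text \<open>Countable additivity in a form that allows index tuples, not only \<open>nat\<close>, as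
  indices.\<close>

lemma (in finite_measure) has_sum_measure_UN:
  assumes "countable I" "\<And>i. i \<in> I \<Longrightarrow> X i \<in> sets M" "disjoint_family_on X I"
  shows "((\<lambda>i. measure M (X i)) has_sum measure M (\<Union>i\<in>I. X i)) I"
  using emeasure_UN_countable[OF assms(2,1,3)]
  by (subst nn_integral_count_space_eq_iff_has_sum[symmetric]) (simp_all add: emeasure_eq_measure)

lemma has_sum_pmf: "(pmf p has_sum measure_pmf.prob p A) A"
proof -
  have "pmf p summable_on A"
    using abs_summable_equivalent abs_summable_summable pmf_abs_summable by blast
  then show ?thesis
    by (simp add: measure_pmf_conv_infsetsum infsetsum_infsum[OF pmf_abs_summable])
qed

text \<open>Partitions \<open>A\<close> into the fibres of \<open>h\<close>; nonnegativity turns the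
  iterated sum into summability of the double family. With \<open>h\<close> a coordinate, it
  recovers the total mass of a matrix from one marginal.\<close>

lemma has_sum_fibres:
  fixes f :: "'a \<Rightarrow> real"
  assumes fibre: "\<And>m. (f has_sum g m) {x \<in> A. h x = m}"
    and g: "(g has_sum S) UNIV"
    and nonneg: "\<And>x. x \<in> A \<Longrightarrow> f x \<ge> 0"
  shows "(f has_sum S) A"
proof -
  let ?B = "\<lambda>m. {x \<in> A. h x = m}"
  have "(\<lambda>(m, x). f x) summable_on Sigma UNIV ?B"
    using fibre has_sum_imp_summable[OF g] nonneg by (intro summable_on_SigmaI) auto
  then have "((\<lambda>(m, x). f x) has_sum S) (Sigma UNIV ?B)"
    using fibre g by (intro has_sum_SigmaI) auto
  also have "?this \<longleftrightarrow> (f has_sum S) A"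
    by (rule has_sum_reindex_bij_witness[of _ "\<lambda>x. (h x, x)" snd]) auto
  finally show ?thesis .
qed

section \<open>First occurrences and the instantiated ABox\<close>

lemma first_at_unique: "first_at I n \<phi> i \<Longrightarrow> first_at I n \<phi> j \<Longrightarrow> i = j"
  unfolding first_at_def by (metis linorder_neqE_nat)

text \<open>The assertions removed from \<open>A\<close> are exactly its distribution eventualities,
  so the ordinary part survives unchanged, and the literals added for \<open>i\<close> spell out
  \<open>first_at\<close>.\<close>

lemma temporal_model_instantiated_abox_iff:
  assumes "{DistEv (n i) (\<delta> i) (\<theta> i) | i. i \<in> {1..d}} = {\<alpha> \<in> A. is_DistEv \<alpha>}"
  shows "temporal_model I Ont (instantiated_abox d n \<delta> \<theta> A k) \<longleftrightarrow>
    temporal_model I Ont (Ordinary -` A) \<and> (\<forall>i\<in>{1..d}. first_at I (n i) (\<theta> i) (k i))"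
proof -
  have "Ordinary -` (A - {\<alpha> \<in> A. is_DistEv \<alpha>}) = Ordinary -` A"
    by auto
  then have abox: "instantiated_abox d n \<delta> \<theta> A k =
    (\<Union>i\<in>{1..d}. {Neg (n i + j) (\<theta> i) | j. j < k i} \<union> {Pos (n i + k i) (\<theta> i)}) \<union>
     Ordinary -` A"
    unfolding instantiated_abox_def assms by simp
  have fixed: "(\<forall>\<alpha>\<in>{Neg (n i + j) (\<theta> i) | j. j < k i}. sat_tassertion I \<alpha>) \<and>
      (\<forall>\<alpha>\<in>{Pos (n i + k i) (\<theta> i)}. sat_tassertion I \<alpha>) \<longleftrightarrow>
      first_at I (n i) (\<theta> i) (k i)" for i
    by (auto simp: first_at_def)
  show ?thesis
    unfolding temporal_model_def abox ball_Un ball_UN fixed by blast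
qed

section \<open>Discrete models\<close>

text \<open>The space of \<open>measure_pmf r\<close> contains every interpretation, including those
  that are not models. Restricting to the support leaves only models, keeps total mass 1 and makes
  every subset measurable.\<close>

lemma kb_satisfiable_pmfI:
  fixes r :: "('c, 'r, 'i, 'u) tinterp pmf"
  assumes "\<And>I. I \<in> set_pmf r \<Longrightarrow> temporal_model I Ont (Ordinary -` A)"
    and "\<And>n \<delta> \<phi> i. DistEv n \<delta> \<phi> \<in> A \<Longrightarrow> measure_pmf.prob r {I. first_at I n \<phi> i} = pmf \<delta> i"
  shows "kb_satisfiable TYPE('u) Ont A"
proof -
  let ?\<mu> = "restrict_space (measure_pmf r) (set_pmf r)"
  have "kb_model (set_pmf r) ?\<mu> Ont A"
    unfolding kb_model_def
  proof (intro conjI ballI allI impI)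
    have "emeasure ?\<mu> (set_pmf r) = emeasure (measure_pmf r) (set_pmf r)"
      by (rule emeasure_restrict_space) auto
    also have "\<dots> = 1"
      using emeasure_Int_set_pmf[of r UNIV] measure_pmf.emeasure_space_1[of r] by simp
    finally show "prob_space ?\<mu>"
      by (intro prob_spaceI) (simp add: space_restrict_space)
    show "space ?\<mu> = set_pmf r"
      by (simp add: space_restrict_space)
    show "temporal_model I Ont (Ordinary -` A)" if "I \<in> set_pmf r" for I
      using assms(1) that .
    fix n \<delta> \<phi> i assume ev: "DistEv n \<delta> \<phi> \<in> A"
    let ?E = "{I \<in> set_pmf r. first_at I n \<phi> i}"
    show "?E \<in> sets ?\<mu>"
      by (auto simp: sets_restrict_space)
    have "measure ?\<mu> ?E = measure_pmf.prob r ?E"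
      by (rule measure_restrict_space) auto
    also have "\<dots> = measure_pmf.prob r ({I. first_at I n \<phi> i} \<inter> set_pmf r)"
      by (rule arg_cong[where f = "measure_pmf.prob r"]) auto
    also have "\<dots> = pmf \<delta> i"
      using assms(2)[OF ev] by (simp add: measure_Int_set_pmf)
    finally show "measure ?\<mu> ?E = pmf \<delta> i" .
  qed
  then show ?thesis
    unfolding kb_satisfiable_def by blast
qed

section \<open>From a model to a matrix\<close>

lemma kb_satisfiable_imp_matrix:
  fixes A :: "('c, 'r, 'i) abox"
  assumes ev: "{DistEv (n i) (\<delta> i) (\<theta> i) | i. i \<in> {1..d}} = {\<alpha> \<in> A. is_DistEv \<alpha>}"
    and model: "kb_model (\<II> :: ('c, 'r, 'i, 'u) tinterp set) \<mu> Ont A"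
  shows "\<exists>M :: (nat \<Rightarrow> nat) \<Rightarrow> real.
       (\<forall>k \<in> index_tuples d. M k \<in> {0..1}) \<and>
       (\<forall>k \<in> index_tuples d. M k > 0 \<longrightarrow>
          temporal_satisfiable TYPE('u) Ont (instantiated_abox d n \<delta> \<theta> A k)) \<and>
       (\<forall>i \<in> {1..d}. \<forall>m. (M has_sum pmf (\<delta> i) m) {k \<in> index_tuples d. k i = m})"
proof -
  interpret prob_space \<mu>
    using model by (simp add: kb_model_def)
  have space: "space \<mu> = \<II>"
    and temporal: "\<And>I. I \<in> \<II> \<Longrightarrow> temporal_model I Ont (Ordinary -` A)"
    using model by (auto simp: kb_model_def)
  \<comment> \<open>\<open>F i m\<close> is the event of a single first occurrence;
    \<open>E k\<close> is the joint event whose probability becomes the matrix entry at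
    \<open>k\<close>.\<close>
  define F where "F i m = {I \<in> \<II>. first_at I (n i) (\<theta> i) m}" for i m
  define E where "E k = {I \<in> \<II>. \<forall>i\<in>{1..d}. first_at I (n i) (\<theta> i) (k i)}" for k
  have F: "F i m \<in> sets \<mu> \<and> measure \<mu> (F i m) = pmf (\<delta> i) m" if "i \<in> {1..d}" for i m
  proof -
    have "DistEv (n i) (\<delta> i) (\<theta> i) \<in> A"
      using ev that by blast
    then show ?thesis
      using model unfolding kb_model_def F_def by blast
  qed
  have E_sets: "E k \<in> sets \<mu>" for k
    unfolding E_def space[symmetric] using F
    by (intro sets.sets_Collect_finite_All) (simp_all add: space F_def)
  have E_disj: "disjoint_family_on E (index_tuples d)"
    unfolding disjoint_family_on_def
  proof (intro ballI impI)
    fix k l assume kl: "k \<in> index_tuples d" "l \<in> index_tuples d" "k \<noteq> l"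
    \<comment> \<open>Index tuples agree outside \<open>{1..d}\<close>, so distinct ones differ at a
      coordinate that \<open>E\<close> constrains.\<close>
    then obtain i where "i \<in> {1..d}" "k i \<noteq> l i"
      using PiE_ext by metis
    then show "E k \<inter> E l = {}"
      unfolding E_def using first_at_unique by blast
  qed
  have occurs: "AE I in \<mu>. \<exists>m. I \<in> F i m" if i: "i \<in> {1..d}" for i
  proof -
    have "disjoint_family (F i)"
      unfolding disjoint_family_on_def F_def using first_at_unique by blast
    then have "((\<lambda>m. measure \<mu> (F i m)) has_sum measure \<mu> (\<Union>m. F i m)) UNIV"
      using F[OF i] by (intro has_sum_measure_UN) simp_all
    moreover have "(\<lambda>m. measure \<mu> (F i m)) = pmf (\<delta> i)"
      using F[OF i] by auto
    moreover have "(pmf (\<delta> i) has_sum 1) UNIV"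
      using has_sum_pmf[of "\<delta> i" UNIV] by simp
    ultimately have "prob (\<Union>m. F i m) = 1"
      using has_sum_unique by fastforce
    then show ?thesis
      using AE_prob_1[of "\<Union>m. F i m"] by simp
  qed
  have countable: "countable (index_tuples d)"
    by (intro countable_PiE) auto
  have marginal: "((\<lambda>k. measure \<mu> (E k)) has_sum pmf (\<delta> i) m) {k \<in> index_tuples d. k i = m}"
    if i: "i \<in> {1..d}" for i m
  proof -
    let ?T = "{k \<in> index_tuples d. k i = m}"
    have "AE I in \<mu>. \<forall>j\<in>{1..d}. \<exists>m. I \<in> F j m"
      using occurs by (intro AE_finite_allI) auto
    \<comment> \<open>The forward implication holds everywhere; the converse needs all the other
      eventualities to occur as well, which is only almost sure.\<close>
    then have "AE I in \<mu>. I \<in> (\<Union>k\<in>?T. E k) \<longleftrightarrow> I \<in> F i m"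
    proof eventually_elim
      case (elim I)
      show ?case
      proof
        assume "I \<in> (\<Union>k\<in>?T. E k)"
        then show "I \<in> F i m"
          using i by (auto simp: E_def F_def)
      next
        assume I: "I \<in> F i m"
        obtain t where t: "\<And>j. j \<in> {1..d} \<Longrightarrow> I \<in> F j (t j)"
          using elim by metis
        then have "t i = m"
          using I i first_at_unique unfolding F_def by blast
        \<comment> \<open>Restricting the vector of occurrence times makes it
          \<open>undefined\<close> outside \<open>{1..d}\<close>, as membership in
          \<open>index_tuples d\<close> demands.\<close>
        then have "restrict t {1..d} \<in> ?T"
          using i by auto
        moreover have "I \<in> E (restrict t {1..d})"
          using t I by (auto simp: E_def F_def)
        ultimately show "I \<in> (\<Union>k\<in>?T. E k)"
          by blast
      qed
    qed
    moreover have T: "countable ?T"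
      using countable by (rule countable_subset[rotated]) auto
    ultimately have "measure \<mu> (\<Union>k\<in>?T. E k) = measure \<mu> (F i m)"
      using E_sets F[OF i]
      by (intro finite_measure_eq_AE sets.countable_UN') auto
    moreover have "((\<lambda>k. measure \<mu> (E k)) has_sum measure \<mu> (\<Union>k\<in>?T. E k)) ?T"
      using T E_sets disjoint_family_on_mono[OF _ E_disj] by (intro has_sum_measure_UN) auto
    ultimately show ?thesis
      using F[OF i] by simp
  qed
  have "temporal_satisfiable TYPE('u) Ont (instantiated_abox d n \<delta> \<theta> A k)"
    if "measure \<mu> (E k) > 0" for k
  proof -
    have "E k \<noteq> {}"
      using that by auto
    then obtain I where "I \<in> E k"
      by blast
    then have "temporal_model I Ont (instantiated_abox d n \<delta> \<theta> A k)"
      using temporal by (simp add: temporal_model_instantiated_abox_iff[OF ev] E_def)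
    then show ?thesis
      unfolding temporal_satisfiable_def by blast
  qed
  then show ?thesis
    using marginal by (intro exI[of _ "\<lambda>k. measure \<mu> (E k)"]) auto
qed

section \<open>From a matrix to a discrete model\<close>

lemma matrix_imp_kb_satisfiable:
  fixes A :: "('c, 'r, 'i) abox" and M :: "(nat \<Rightarrow> nat) \<Rightarrow> real"
  assumes "d \<ge> 1"
    and ev: "{DistEv (n i) (\<delta> i) (\<theta> i) | i. i \<in> {1..d}} = {\<alpha> \<in> A. is_DistEv \<alpha>}"
    and nonneg: "\<And>k. k \<in> index_tuples d \<Longrightarrow> M k \<ge> 0"
    and sat: "\<And>k. k \<in> index_tuples d \<Longrightarrow> M k > 0 \<Longrightarrow>
          temporal_satisfiable TYPE('u) Ont (instantiated_abox d n \<delta> \<theta> A k)"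
    and marginal: "\<And>i m. i \<in> {1..d} \<Longrightarrow>
          (M has_sum pmf (\<delta> i) m) {k \<in> index_tuples d. k i = m}"
  shows "kb_satisfiable TYPE('u) Ont A"
proof -
  \<comment> \<open>A pmf on tuples lives on all of \<open>nat \<Rightarrow> nat\<close>, while
    \<open>M\<close> is unconstrained off the index tuples; hence the extension by 0.\<close>
  define f where "f k = (if k \<in> index_tuples d then M k else 0)" for k
  have f_nonneg: "f k \<ge> 0" for k
    using nonneg by (simp add: f_def)
  have "(M has_sum 1) (index_tuples d)"
  proof (rule has_sum_fibres)
    \<comment> \<open>Here \<open>d \<ge> 1\<close> enters: it provides coordinate 1, whose marginal
      fixes the total mass.\<close>
    show "(M has_sum pmf (\<delta> 1) m) {k \<in> index_tuples d. k 1 = m}" for m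
      using marginal[of 1 m] \<open>d \<ge> 1\<close> by simp
    show "(pmf (\<delta> 1) has_sum 1) UNIV"
      using has_sum_pmf[of "\<delta> 1" UNIV] by simp
  qed (rule nonneg)
  then have "(f has_sum 1) UNIV"
    by (rule has_sum_cong_neutral[THEN iffD1, rotated -1]) (auto simp: f_def)
  then have f_mass: "(\<integral>\<^sup>+k. ennreal (f k) \<partial>count_space UNIV) = 1"
    using f_nonneg nn_integral_count_space_eq_iff_has_sum[of UNIV f 1] by simp
  define p where "p = embed_pmf f"
  have pmf_p: "pmf p k = f k" for k
    unfolding p_def using f_nonneg f_mass by (rule pmf_embed_pmf)
  have supp: "k \<in> index_tuples d \<and> M k > 0" if "k \<in> set_pmf p" for k
    using that nonneg[of k] by (auto simp: set_pmf_eq pmf_p f_def split: if_splits)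
  have "\<forall>k\<in>set_pmf p. \<exists>I :: ('c, 'r, 'i, 'u) tinterp.
      temporal_model I Ont (instantiated_abox d n \<delta> \<theta> A k)"
    using sat supp unfolding temporal_satisfiable_def by blast
  \<comment> \<open>\<open>J\<close> is constrained only on the support of \<open>p\<close>, and
    \<open>map_pmf J p\<close> sees no other values.\<close>
  then obtain J :: "(nat \<Rightarrow> nat) \<Rightarrow> ('c, 'r, 'i, 'u) tinterp" where
    J: "\<And>k. k \<in> set_pmf p \<Longrightarrow> temporal_model (J k) Ont (instantiated_abox d n \<delta> \<theta> A k)"
    by metis
  note J' = J[unfolded temporal_model_instantiated_abox_iff[OF ev]]
  have "measure_pmf.prob (map_pmf J p) {I. first_at I n' \<phi> m} = pmf \<delta>' m"
    if "DistEv n' \<delta>' \<phi> \<in> A" for n' \<delta>' \<phi> m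
  proof -
    have "DistEv n' \<delta>' \<phi> \<in> {DistEv (n i) (\<delta> i) (\<theta> i) | i. i \<in> {1..d}}"
      unfolding ev using that by simp
    then obtain i where i: "i \<in> {1..d}" "n' = n i" "\<delta>' = \<delta> i" "\<phi> = \<theta> i"
      by auto
    \<comment> \<open>The temporal model \<open>J k\<close> has its first occurrence for
      \<open>i\<close> at \<open>k i\<close>, so pulling the event back along \<open>J\<close>
      gives, up to tuples of mass 0, the slice summed in the \<open>i\<close>-th marginal.\<close>
    have first: "first_at (J k) n' \<phi> m \<longleftrightarrow> k i = m" if "k \<in> set_pmf p" for k
      using J'[OF that] i first_at_unique by blast
    let ?T = "{k \<in> index_tuples d. k i = m}"
    have "measure_pmf.prob (map_pmf J p) {I. first_at I n' \<phi> m} =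
        measure_pmf.prob p {k. first_at (J k) n' \<phi> m}"
      by (simp add: vimage_def)
    also have "\<dots> = measure_pmf.prob p ?T"
      using first supp by (intro measure_prob_cong_0) (auto simp: set_pmf_iff)
    also have "\<dots> = pmf \<delta>' m"
    proof (rule has_sum_unique[where f = "pmf p" and A = ?T])
      show "(pmf p has_sum measure_pmf.prob p ?T) ?T"
        by (rule has_sum_pmf)
      show "(pmf p has_sum pmf \<delta>' m) ?T"
        using marginal[OF i(1), of m] i(3)
        by (subst has_sum_cong[where g = M]) (auto simp: pmf_p f_def)
    qed
    finally show ?thesis .
  qed
  then show ?thesis
    using J' by (intro kb_satisfiable_pmfI[of "map_pmf J p"]) auto
qed

section \<open>Equivalence of satisfiability and the matrix condition\<close>

theorem theorem2:
  fixes Ont :: "('c, 'r) ontology"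
    and A :: "('c, 'r, 'i) abox"
    and d :: nat
    and n :: "nat \<Rightarrow> nat"
    and \<delta> :: "nat \<Rightarrow> nat pmf"
    and \<theta> :: "nat \<Rightarrow> ('c, 'r, 'i) atom"
  assumes "d \<ge> 1"
    and "bij_betw (\<lambda>i. DistEv (n i) (\<delta> i) (\<theta> i)) {1..d} {\<alpha> \<in> A. is_DistEv \<alpha>}"
  shows "kb_satisfiable TYPE('u) Ont A \<longleftrightarrow>
    (\<exists>M :: (nat \<Rightarrow> nat) \<Rightarrow> real.
       (\<forall>k \<in> index_tuples d. M k \<in> {0..1}) \<and>
       (\<forall>k \<in> index_tuples d. M k > 0 \<longrightarrow>
          temporal_satisfiable TYPE('u) Ont (instantiated_abox d n \<delta> \<theta> A k)) \<and>
       (\<forall>i \<in> {1..d}. \<forall>m. (M has_sum pmf (\<delta> i) m) {k \<in> index_tuples d. k i = m}))"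
proof -
  have ev: "{DistEv (n i) (\<delta> i) (\<theta> i) | i. i \<in> {1..d}} = {\<alpha> \<in> A. is_DistEv \<alpha>}"
    using bij_betw_imp_surj_on[OF assms(2)] unfolding Setcompr_eq_image .
  show ?thesis (is "_ \<longleftrightarrow> ?matrix")
  proof
    assume "kb_satisfiable TYPE('u) Ont A"
    then obtain \<II> :: "('c, 'r, 'i, 'u) tinterp set" and \<mu> where "kb_model \<II> \<mu> Ont A"
      unfolding kb_satisfiable_def by blast
    with ev show ?matrix
      by (rule kb_satisfiable_imp_matrix)
  next
    assume ?matrix
    then obtain M :: "(nat \<Rightarrow> nat) \<Rightarrow> real" where M:
      "\<forall>k \<in> index_tuples d. M k \<in> {0..1}"
      "\<forall>k \<in> index_tuples d. M k > 0 \<longrightarrow>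
          temporal_satisfiable TYPE('u) Ont (instantiated_abox d n \<delta> \<theta> A k)"
      "\<forall>i \<in> {1..d}. \<forall>m. (M has_sum pmf (\<delta> i) m) {k \<in> index_tuples d. k i = m}"
      by (elim exE conjE)
    show "kb_satisfiable TYPE('u) Ont A"
    proof (rule matrix_imp_kb_satisfiable[OF \<open>d \<ge> 1\<close> ev])
      show "M k \<ge> 0" if "k \<in> index_tuples d" for k
        using M(1) that by (meson atLeastAtMost_iff)
    qed (use M(2,3) in blast)+
  qed
qed

end
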